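(* Let $\mathbf{M}$ be the invertible $(N+1)\times(N+1)$ matrix with $Q(x)=\mathbf{M}X(x)$ and $X(x)=\mathbf{M}^{-1}Q(x)$, and let $\mathbf{D}$ be the $(N+1)\times(N+1)$ matrix with $\frac{d}{dx}Q(x)=\mathbf{D}\,Q(x)$ (the operational matrix of derivative of $Q$). Then $$\mathbf{D}=\mathbf{M}P\mathbf{M}^{-1},$$ where $P$ is the $(N+1)\times(N+1)$ matrix, with rows and columns indexed by $i,j=0,1,\dots,N$, given by $P_{i,j}=i$ if $i-j=1$ and $P_{i,j}=0$ otherwise.
   Context: Fix real numbers $a<b$ and a natural number $N$. For $n=0,1,\dots,N$, the Bessel polynomials are $$B_n(x)=\sum_{r=0}^{\lfloor (N-n)/2\rfloor}\frac{(-1)^r}{r!\,(n+r)!}\left(\frac{x}{2}\right)^{2r+n},$$ and the shifted Bessel polynomials on $[a,b]$ are $Q_n(x)=B_n\left(\frac{x-a}{b-a}\right)$, $x\in[a,b]$. Put $Q(x)=[Q_0(x),Q_1(x),\dots,Q_N(x)]^T$ and $X(x)=[1,x,\dots,x^N]^T$. Identities between vector functions hold for all $x\in[a,b]$. The matrix $\mathbf{M}$ is the (constant, real) change-of-basis matrix expressing the $Q_n$ in the monomials $1,x,\dots,x^N$; it is invertible. The matrix $P$ satisfies $\frac{d}{dx}X(x)=P\,X(x)$. *)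

theory Defs
  imports Complex_Main "Jordan_Normal_Form.Matrix"
begin

definition bessel_poly :: "nat \<Rightarrow> nat \<Rightarrow> real \<Rightarrow> real" where
  "bessel_poly N n x =
     (\<Sum>r = 0..(N - n) div 2. (-1) ^ r / (fact r * fact (n + r)) * (x / 2) ^ (2 * r + n))"

definition shifted_bessel :: "real \<Rightarrow> real \<Rightarrow> nat \<Rightarrow> nat \<Rightarrow> real \<Rightarrow> real" where
  "shifted_bessel a b N n x = bessel_poly N n ((x - a) / (b - a))"

definition bessel_vec :: "real \<Rightarrow> real \<Rightarrow> nat \<Rightarrow> real \<Rightarrow> real vec" where
  "bessel_vec a b N x = vec (N + 1) (\<lambda>n. shifted_bessel a b N n x)"

definition monom_vec :: "nat \<Rightarrow> real \<Rightarrow> real vec" where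
  "monom_vec N x = vec (N + 1) (\<lambda>n. x ^ n)"

definition monom_deriv_mat :: "nat \<Rightarrow> real mat" where
  "monom_deriv_mat N = mat (N + 1) (N + 1) (\<lambda>(i, j). if i = j + 1 then real i else 0)"

text \<open>The type of vectors carries no topology, so the derivative of a vector function is taken
  entrywise; it is one-sided at the endpoints of \<open>S = {a..b}\<close>.\<close>

definition deriv_operational_mat :: "real set \<Rightarrow> nat \<Rightarrow> (real \<Rightarrow> real vec) \<Rightarrow> real mat \<Rightarrow> bool" where
  "deriv_operational_mat S m \<Phi> D \<longleftrightarrow>
     D \<in> carrier_mat m m \<and>
     (\<forall>x\<in>S. \<forall>i<m. ((\<lambda>t. \<Phi> t $ i) has_real_derivative (D *\<^sub>v \<Phi> x) $ i) (at x within S))"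

end

theory Submission
  imports Defs
begin

text \<open>Differentiating \<open>Q = \<^bold>M X\<close> gives \<open>\<^bold>D \<^bold>M X = \<^bold>M P X\<close> on the interval. A polynomial vanishing at
  infinitely many points is zero, so \<open>\<^bold>D \<^bold>M = \<^bold>M P\<close>, and it remains to multiply by the inverse of
  \<open>\<^bold>M\<close>.\<close>

lemma monom_vec_carrier: "monom_vec N x \<in> carrier_vec (N + 1)"
  by (simp add: monom_vec_def)

lemma monom_deriv_mat_carrier: "monom_deriv_mat N \<in> carrier_mat (N + 1) (N + 1)"
  by (simp add: monom_deriv_mat_def)

lemma mult_monom_vec_index:
  assumes "A \<in> carrier_mat m (N + 1)" "i < m"
  shows "(A *\<^sub>v monom_vec N x) $ i = (\<Sum>j\<le>N. A $$ (i, j) * x ^ j)"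
  using assms
  by (auto simp: monom_vec_def scalar_prod_def lessThan_Suc_atMost atLeast0LessThan
      simp del: sum.lessThan_Suc intro!: sum.cong)

text \<open>Row \<open>i\<close> of \<open>A - B\<close> lists the coefficients of a polynomial of
  degree at most \<open>N\<close> that vanishes on all of \<open>S\<close>. With infinitely many
  roots, each coefficient must be 0.\<close>

lemma mat_eq_if_mult_monom_vec_eq:
  assumes A: "A \<in> carrier_mat m (N + 1)" and B: "B \<in> carrier_mat m (N + 1)"
    and "infinite S" and eq: "\<And>x. x \<in> S \<Longrightarrow> A *\<^sub>v monom_vec N x = B *\<^sub>v monom_vec N x"
  shows "A = B"
proof (rule eq_matI)
  fix i j assume "i < dim_row B" "j < dim_col B"
  with B have i: "i < m" and j: "j \<le> N" by auto
  let ?c = "\<lambda>j. A $$ (i, j) - B $$ (i, j)"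
  have "S \<subseteq> {x. (\<Sum>j\<le>N. ?c j * x ^ j) = 0}"
    by (auto simp: left_diff_distrib sum_subtractf eq
        simp flip: mult_monom_vec_index[OF A i] mult_monom_vec_index[OF B i])
  then have "infinite {x. (\<Sum>j\<le>N. ?c j * x ^ j) = 0}"
    using \<open>infinite S\<close> finite_subset by blast
  then show "A $$ (i, j) = B $$ (i, j)"
    using polyfun_finite_roots[of ?c N] j by auto
qed (use A B in auto)

lemma monom_vec_has_derivative:
  assumes "j < N + 1"
  shows "((\<lambda>t. monom_vec N t $ j) has_real_derivative (monom_deriv_mat N *\<^sub>v monom_vec N x) $ j) (at x)"
proof -
  have "(monom_deriv_mat N *\<^sub>v monom_vec N x) $ j =
      (\<Sum>k\<le>N. if j = k + 1 then real j * x ^ k else 0)"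
    using assms
    by (subst mult_monom_vec_index[OF monom_deriv_mat_carrier])
      (auto simp: monom_deriv_mat_def intro!: sum.cong)
  \<comment> \<open>Only \<open>k = j - 1\<close> contributes. For \<open>j = 0\<close> no
    \<open>k\<close> does, and the factor \<open>real j\<close> makes the truncated exponent
    harmless.\<close>
  also have "\<dots> = real j * x ^ (j - 1)"
    using assms by (cases j) (auto simp: sum.delta')
  finally show ?thesis
    using assms by (auto simp: monom_vec_def intro!: derivative_eq_intros)
qed

text \<open>Since \<open>A\<close> is constant, each entry of the product is a fixed linear
  combination of the entries of \<open>f\<close>, so differentiation passes through
  \<open>A\<close>.\<close>

lemma mult_mat_vec_has_derivative:
  fixes A :: "real mat"
  assumes A: "A \<in> carrier_mat m n" and "i < m"
    and f: "\<And>t. f t \<in> carrier_vec n" and f': "f' \<in> carrier_vec n"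
    and deriv: "\<And>j. j < n \<Longrightarrow> ((\<lambda>t. f t $ j) has_real_derivative f' $ j) (at x within S)"
  shows "((\<lambda>t. (A *\<^sub>v f t) $ i) has_real_derivative (A *\<^sub>v f') $ i) (at x within S)"
proof -
  have index: "(A *\<^sub>v v) $ i = (\<Sum>j<n. A $$ (i, j) * v $ j)" if "v \<in> carrier_vec n" for v
    using A \<open>i < m\<close> that by (auto simp: scalar_prod_def atLeast0LessThan intro!: sum.cong)
  show ?thesis
    unfolding index[OF f] index[OF f'] by (intro DERIV_sum DERIV_cmult deriv) simp
qed

theorem lemma1:
  fixes a b :: real and N :: nat and M Minv D :: "real mat"
  assumes "a < b"
    and "M \<in> carrier_mat (N + 1) (N + 1)"
    and "Minv \<in> carrier_mat (N + 1) (N + 1)"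
    and "inverts_mat M Minv" and "inverts_mat Minv M"
    and "\<forall>x\<in>{a..b}. bessel_vec a b N x = M *\<^sub>v monom_vec N x"
    and "\<forall>x\<in>{a..b}. monom_vec N x = Minv *\<^sub>v bessel_vec a b N x"
    and "deriv_operational_mat {a..b} (N + 1) (bessel_vec a b N) D"
  shows "D = M * monom_deriv_mat N * Minv"
proof -
  let ?P = "monom_deriv_mat N" and ?X = "monom_vec N" and ?Q = "bessel_vec a b N"
  note M = assms(2) and Minv = assms(3) and Q = assms(6)
  have D: "D \<in> carrier_mat (N + 1) (N + 1)"
    using assms(8) by (simp add: deriv_operational_mat_def)
  have "D * M = M * ?P"
  proof (rule mat_eq_if_mult_monom_vec_eq)
    \<comment> \<open>The open interval is still infinite, and at its points the derivative within
      \<open>{a..b}\<close> is the two-sided one, so derivatives are unique there.\<close>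
    show "infinite {a<..<b}" using \<open>a < b\<close> by simp
  next
    fix x assume x: "x \<in> {a<..<b}"
    have "(D *\<^sub>v ?Q x) $ i = (M *\<^sub>v (?P *\<^sub>v ?X x)) $ i" if i: "i < N + 1" for i
    proof (rule DERIV_unique)
      show "((\<lambda>t. ?Q t $ i) has_real_derivative (D *\<^sub>v ?Q x) $ i) (at x)"
        using assms(8) x i by (auto simp: deriv_operational_mat_def at_within_Icc_at
            dest!: bspec[of _ _ x])
      have "((\<lambda>t. (M *\<^sub>v ?X t) $ i) has_real_derivative (M *\<^sub>v (?P *\<^sub>v ?X x)) $ i) (at x)"
        by (intro mult_mat_vec_has_derivative[OF M i] monom_vec_has_derivative
            mult_mat_vec_carrier[OF monom_deriv_mat_carrier] monom_vec_carrier)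
      then show "((\<lambda>t. ?Q t $ i) has_real_derivative (M *\<^sub>v (?P *\<^sub>v ?X x)) $ i) (at x)"
        \<comment> \<open>\<open>?Q\<close> and \<open>M *\<^sub>v ?X\<close> are known to agree
          only on \<open>{a..b}\<close>; an open neighbourhood of \<open>x\<close> inside it
          suffices to transfer the derivative.\<close>
        by (rule has_field_derivative_transform_within_open[of _ _ _ "{a<..<b}"])
          (use x Q in auto)
    qed
    then have "D *\<^sub>v ?Q x = M *\<^sub>v (?P *\<^sub>v ?X x)"
      using D M by (intro eq_vecI) auto
    \<comment> \<open>Replacing \<open>?Q x\<close> by \<open>M *\<^sub>v ?X x\<close> leaves two
      constant matrices applied to the same monomial vector.\<close>
    then show "(D * M) *\<^sub>v ?X x = (M * ?P) *\<^sub>v ?X x"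
      using x Q assoc_mult_mat_vec[OF D M monom_vec_carrier]
        assoc_mult_mat_vec[OF M monom_deriv_mat_carrier monom_vec_carrier] by simp
  qed (use D M monom_deriv_mat_carrier in auto)
  moreover have "D = D * M * Minv"
    using D M Minv \<open>inverts_mat M Minv\<close> by (simp add: inverts_mat_def)
  ultimately show ?thesis by simp
qed

end
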